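(* If $\mathcal{A}\subseteq M_n(\mathbb{C})$ is logmodular, then $\mathcal{A}$ is unitarily equivalent to an algebra of block upper triangular matrices; that is, there exist a unitary $U\in M_n(\mathbb{C})$ and positive integers $n_1,\dots,n_r$ with $n_1+\dots+n_r=n$ such that $U\mathcal{A}U^*$ equals the algebra of all matrices in $M_n(\mathbb{C})$ which, written in $r\times r$ block form with respect to the decomposition $\mathbb{C}^n=\mathbb{C}^{n_1}\oplus\dots\oplus\mathbb{C}^{n_r}$, have all blocks below the block diagonal equal to zero.
   Context: A unital subalgebra $\mathcal{A}\subseteq M_n(\mathbb{C})$ (containing the identity $1_n$) is called logmodular (in $M_n(\mathbb{C})$) if the set $\{a^*a : a\in\mathcal{A}^{-1}\}$ is dense in the set of positive invertible matrices in $M_n(\mathbb{C})$, where $\mathcal{A}^{-1}$ denotes the set of elements of $\mathcal{A}$ invertible in $\mathcal{A}$. *)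

theory Defs
  imports Complex_Main "Jordan_Normal_Form.Matrix"
begin

definition adj :: "complex mat \<Rightarrow> complex mat" where
  "adj M = mat (dim_col M) (dim_row M) (\<lambda>(i,j). cnj (M $$ (j,i)))"

definition unitary_n :: "nat \<Rightarrow> complex mat \<Rightarrow> bool" where
  "unitary_n n U \<longleftrightarrow> U \<in> carrier_mat n n \<and> U * adj U = 1\<^sub>m n \<and> adj U * U = 1\<^sub>m n"

definition pos_invertible :: "nat \<Rightarrow> complex mat \<Rightarrow> bool" where
  "pos_invertible n P \<longleftrightarrow> P \<in> carrier_mat n n \<and> adj P = P \<and> invertible_mat P \<and>
     (\<forall>v :: nat \<Rightarrow> complex. 0 \<le> Re (\<Sum>i<n. \<Sum>j<n. cnj (v i) * P $$ (i,j) * v j))"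

definition unital_subalgebra :: "nat \<Rightarrow> complex mat set \<Rightarrow> bool" where
  "unital_subalgebra n A \<longleftrightarrow> A \<subseteq> carrier_mat n n \<and> 1\<^sub>m n \<in> A \<and>
     (\<forall>a\<in>A. \<forall>b\<in>A. a + b \<in> A \<and> a * b \<in> A) \<and>
     (\<forall>c::complex. \<forall>a\<in>A. c \<cdot>\<^sub>m a \<in> A)"

definition invertible_in :: "complex mat set \<Rightarrow> complex mat \<Rightarrow> bool" where
  "invertible_in A a \<longleftrightarrow> a \<in> A \<and> (\<exists>b\<in>A. a * b = 1\<^sub>m (dim_row a) \<and> b * a = 1\<^sub>m (dim_row a))"

text \<open>Logmodular: {a^* a : a in A^{-1}} is dense in the positive invertible
  matrices (topology of M_n(C), given by entrywise convergence).\<close>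
definition logmodular :: "nat \<Rightarrow> complex mat set \<Rightarrow> bool" where
  "logmodular n A \<longleftrightarrow> unital_subalgebra n A \<and>
     (\<forall>P. pos_invertible n P \<longrightarrow> (\<forall>\<epsilon>>0. \<exists>a. invertible_in A a \<and>
        (\<forall>i<n. \<forall>j<n. cmod ((adj a * a) $$ (i,j) - P $$ (i,j)) < \<epsilon>)))"

text \<open>Block index of coordinate i w.r.t. block sizes ns = [n_1,...,n_r]
  (0-based): number of complete blocks lying entirely before position i.\<close>
definition blk :: "nat list \<Rightarrow> nat \<Rightarrow> nat" where
  "blk ns i = card {k. k < length ns \<and> sum_list (take (Suc k) ns) \<le> i}"

definition block_upper :: "nat \<Rightarrow> nat list \<Rightarrow> complex mat set" where
  "block_upper n ns = {M \<in> carrier_mat n n.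
     \<forall>i<n. \<forall>j<n. blk ns j < blk ns i \<longrightarrow> M $$ (i,j) = 0}"

end

theory Submission
  imports Defs "Jordan_Normal_Form.Determinant" "HOL-Analysis.Topology_Euclidean_Space"
begin

text \<open>
  By compactness, density upgrades to exact factorization: every invertible R equals v* a with v
  unitary and a invertible in A; thus the GL(n)-orbit of the subspace A (under left multiplication)
  is an orbit of the compact unitary group. Degenerating along diag(1,t,t^2,...) as t tends to
  infinity stays in this orbit and ends at a torus-fixed point, so some unitary conjugate B of A
  contains all diagonal matrices. Then B is spanned by the matrix units E(p,q) with p below q for a
  preorder on the coordinates. Factoring the shears 1 + E(i,j) shows that this preorder is total, and
  sorting the coordinates accordingly yields the block upper triangular form.
\<close>

hide_const (open) Finite_Cartesian_Product.mat

text \<open>Subspaces are controlled through this remark: if \<open>v * R\<close> and its inverse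
  \<open>R' * adj v\<close> both lie in A, then left multiplication by \<open>v * R\<close> maps A
  onto itself, so \<open>R\<close> and \<open>adj v\<close> move A to the same subspace. For this
  the inverses must survive the limit along with the matrices themselves, and they need a
  convergence argument of their own.

  The distinct exponents in diag(1,t,t^2,...) separate the coordinates; stability of the limit
  subspace under each E(k,k) is what puts the conjugated projections into A. No topology on the set
  of subspaces is set up: explicit elements of A with convergent entries take its place, together
  with the closedness of subspaces of C^I for finite I. Since rescaling by t^k leaves some entries
  unbounded, closedness is needed for coordinate projections of A as well as for A.

  Containing the diagonal is not enough: for n = 2 the diagonal matrices themselves form an algebra
  that is not logmodular. Hence the factorization is used a second time, with shears, to exclude
  incomparable coordinates.\<close>

section \<open>Matrix products, adjoints and unitaries\<close>

lemma mult_entry: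
  fixes A B :: "complex mat"
  assumes "A \<in> carrier_mat n n" "B \<in> carrier_mat n n" "i < n" "j < n"
  shows "(A * B) $$ (i,j) = (\<Sum>k<n. A $$ (i,k) * B $$ (k,j))"
  using assms by (auto simp: scalar_prod_def atLeast0LessThan intro!: sum.cong)

lemma mult_square_carrier [simp]:
  "A \<in> carrier_mat n n \<Longrightarrow> B \<in> carrier_mat n n \<Longrightarrow> A * B \<in> carrier_mat n n"
  by (rule mult_carrier_mat)

lemma mult_one_square [simp]:
  fixes A :: "complex mat"
  assumes "A \<in> carrier_mat n n"
  shows "A * 1\<^sub>m n = A" "1\<^sub>m n * A = A"
  using assms by auto

lemma adj_carrier [simp]: "M \<in> carrier_mat n n \<Longrightarrow> adj M \<in> carrier_mat n n"
  by (auto simp: adj_def)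

lemma adj_entry: "M \<in> carrier_mat n n \<Longrightarrow> i < n \<Longrightarrow> j < n \<Longrightarrow> adj M $$ (i,j) = cnj (M $$ (j,i))"
  by (auto simp: adj_def)

lemma adj_adj [simp]: "adj (adj M) = M"
  by (rule eq_matI) (auto simp: adj_def)

lemma adj_mult:
  assumes "A \<in> carrier_mat n n" "B \<in> carrier_mat n n"
  shows "adj (A * B) = adj B * adj A"
proof (rule eq_matI)
  fix i j assume "i < dim_row (adj B * adj A)" "j < dim_col (adj B * adj A)"
  then have ij: "i < n" "j < n" using assms by (auto simp: adj_def)
  have "adj (A * B) $$ (i,j) = cnj ((A * B) $$ (j,i))"
    using assms ij by (intro adj_entry[of _ n]) auto
  also have "\<dots> = (\<Sum>k<n. cnj (A $$ (j,k)) * cnj (B $$ (k,i)))"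
    using assms ij by (simp add: mult_entry del: index_mult_mat(1))
  also have "\<dots> = (adj B * adj A) $$ (i,j)"
    using assms ij by (simp add: mult_entry[of _ n] adj_entry mult.commute del: index_mult_mat(1))
  finally show "adj (A * B) $$ (i,j) = (adj B * adj A) $$ (i,j)" .
qed (use assms in \<open>auto simp: adj_def\<close>)

lemma unitary_carrier: "unitary_n n U \<Longrightarrow> U \<in> carrier_mat n n"
  by (simp add: unitary_n_def)

text \<open>A one-sided inverse of a square matrix is two-sided, so a limit of matrices only has to
  preserve \<open>adj U * U\<close>.\<close>

lemma unitary_nI:
  assumes "U \<in> carrier_mat n n" "adj U * U = 1\<^sub>m n"
  shows "unitary_n n U"
  using assms mat_mult_left_right_inverse[of "adj U" n U] by (simp add: unitary_n_def)

lemma unitary_adj: "unitary_n n U \<Longrightarrow> unitary_n n (adj U)"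
  by (simp add: unitary_n_def)

lemma mult_cancel_mid:
  fixes A B C D :: "complex mat"
  assumes "A \<in> carrier_mat n n" "B \<in> carrier_mat n n" "C \<in> carrier_mat n n" "D \<in> carrier_mat n n"
    and "B * C = 1\<^sub>m n"
  shows "(A * B) * (C * D) = A * D"
proof -
  have "(A * B) * (C * D) = A * ((B * C) * D)"
    using assms(1-4) by (simp add: assoc_mult_mat[of _ n n _ n _ n])
  then show ?thesis using assms by simp
qed

lemma unitary_mult:
  assumes "unitary_n n U" "unitary_n n V"
  shows "unitary_n n (U * V)"
proof (rule unitary_nI)
  show "U * V \<in> carrier_mat n n" using assms by (auto simp: unitary_n_def)
  have c: "U \<in> carrier_mat n n" "V \<in> carrier_mat n n" using assms by (auto simp: unitary_n_def)
  have "adj (U * V) * (U * V) = (adj V * adj U) * (U * V)" using c by (simp add: adj_mult)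
  also have "\<dots> = adj V * V"
    using c assms by (intro mult_cancel_mid) (auto simp: unitary_n_def)
  finally show "adj (U * V) * (U * V) = 1\<^sub>m n" using assms by (simp add: unitary_n_def)
qed

text \<open>The quadratic form at v is the squared norm of Rv, and \<open>R' * adj R'\<close> is the
  inverse. Density is only ever applied to such Gram matrices, so no square root or polar
  decomposition enters.\<close>

lemma pos_invertible_gram:
  assumes R: "R \<in> carrier_mat n n" and R': "R' \<in> carrier_mat n n"
    and inv: "R * R' = 1\<^sub>m n" "R' * R = 1\<^sub>m n"
  shows "pos_invertible n (adj R * R)"
proof -
  have c: "adj R * R \<in> carrier_mat n n" "adj R \<in> carrier_mat n n" "adj R' \<in> carrier_mat n n"
    using R R' by auto
  have inv': "adj R' * adj R = 1\<^sub>m n" "adj R * adj R' = 1\<^sub>m n"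
  proof -
    have "adj (1\<^sub>m n) = 1\<^sub>m n" by (rule eq_matI) (auto simp: adj_def)
    then show "adj R' * adj R = 1\<^sub>m n" "adj R * adj R' = 1\<^sub>m n"
      using inv R R' by (metis adj_mult)+
  qed
  have "(adj R * R) * (R' * adj R') = 1\<^sub>m n"
    using mult_cancel_mid[of "adj R" n R R' "adj R'"] c R R' inv inv' by simp
  moreover have "(R' * adj R') * (adj R * R) = 1\<^sub>m n"
    using mult_cancel_mid[of R' n "adj R'" "adj R" R] c R R' inv inv' by (simp del: assoc_mult_mat)
  moreover have "dim_row (adj R * R) = n" "dim_col (adj R * R) = n" "dim_row (R' * adj R') = n"
    using c R R' by (auto simp: adj_def)
  ultimately have "invertible_mat (adj R * R)"
    unfolding invertible_mat_def inverts_mat_def square_mat.simps by metis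
  moreover have "adj (adj R * R) = adj R * R"
    using adj_mult[of "adj R" n R] R by simp
  moreover have "0 \<le> Re (\<Sum>i<n. \<Sum>j<n. cnj (v i) * (adj R * R) $$ (i,j) * v j)" for v
  proof -
    define y where "y k = (\<Sum>j<n. R $$ (k,j) * v j)" for k
    have "(\<Sum>i<n. \<Sum>j<n. cnj (v i) * (adj R * R) $$ (i,j) * v j)
        = (\<Sum>i<n. \<Sum>j<n. \<Sum>k<n. cnj (R $$ (k,i) * v i) * (R $$ (k,j) * v j))"
      using R by (intro sum.cong refl)
        (simp add: mult_entry[of _ n] adj_entry[of R n] sum_distrib_left sum_distrib_right
          mult_ac del: index_mult_mat(1))
    also have "\<dots> = (\<Sum>i<n. \<Sum>k<n. \<Sum>j<n. cnj (R $$ (k,i) * v i) * (R $$ (k,j) * v j))"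
      by (intro sum.cong refl sum.swap)
    also have "\<dots> = (\<Sum>k<n. \<Sum>i<n. \<Sum>j<n. cnj (R $$ (k,i) * v i) * (R $$ (k,j) * v j))"
      by (rule sum.swap)
    also have "\<dots> = (\<Sum>k<n. cnj (y k) * y k)"
      by (simp add: y_def sum_product)
    finally show ?thesis by (simp add: sum_nonneg)
  qed
  ultimately show ?thesis using c by (simp add: pos_invertible_def)
qed

section \<open>Entrywise limits and compactness\<close>

text \<open>Entrywise convergence matches the way \<open>logmodular\<close> expresses density; the
  carrier conditions are included so that every limit statement also carries the dimensions.\<close>

definition mat_tendsto :: "nat \<Rightarrow> (nat \<Rightarrow> complex mat) \<Rightarrow> complex mat \<Rightarrow> bool" where
  "mat_tendsto n X L \<longleftrightarrow> (\<forall>m. X m \<in> carrier_mat n n) \<and> L \<in> carrier_mat n n \<and>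
     (\<forall>i<n. \<forall>j<n. (\<lambda>m. X m $$ (i,j)) \<longlonglongrightarrow> L $$ (i,j))"

lemma mat_tendsto_const: "L \<in> carrier_mat n n \<Longrightarrow> mat_tendsto n (\<lambda>_. L) L"
  by (simp add: mat_tendsto_def)

lemma mat_tendsto_mult:
  assumes "mat_tendsto n X K" "mat_tendsto n Y L"
  shows "mat_tendsto n (\<lambda>m. X m * Y m) (K * L)"
proof -
  have c: "\<And>m. X m \<in> carrier_mat n n" "\<And>m. Y m \<in> carrier_mat n n"
    "K \<in> carrier_mat n n" "L \<in> carrier_mat n n"
    using assms by (auto simp: mat_tendsto_def)
  have "(\<lambda>m. (X m * Y m) $$ (i,j)) \<longlonglongrightarrow> (K * L) $$ (i,j)" if "i < n" "j < n" for i j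
    using assms that c by (simp add: mult_entry[of _ n] del: index_mult_mat(1))
      (auto simp: mat_tendsto_def intro!: tendsto_sum tendsto_mult)
  then show ?thesis using c by (auto simp: mat_tendsto_def simp del: index_mult_mat(1))
qed

lemma mat_tendsto_adj:
  assumes "mat_tendsto n X K"
  shows "mat_tendsto n (\<lambda>m. adj (X m)) (adj K)"
  using assms by (auto simp: mat_tendsto_def adj_entry[of _ n] intro!: tendsto_cnj)

lemma mat_tendsto_subseq:
  assumes "mat_tendsto n X K" "strict_mono r"
  shows "mat_tendsto n (\<lambda>m. X (r m)) K"
proof -
  have "(\<lambda>m. X (r m) $$ (i,j)) \<longlonglongrightarrow> K $$ (i,j)" if "i < n" "j < n" for i j
    using assms that LIMSEQ_subseq_LIMSEQ[OF _ assms(2), of "\<lambda>m. X m $$ (i,j)"]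
    by (auto simp: mat_tendsto_def o_def)
  then show ?thesis using assms by (simp add: mat_tendsto_def)
qed

lemma mat_tendsto_unique:
  assumes "mat_tendsto n X K" "mat_tendsto n X L"
  shows "K = L"
proof (rule eq_matI)
  show "K $$ (i,j) = L $$ (i,j)" if "i < dim_row L" "j < dim_col L" for i j
    using assms that by (intro LIMSEQ_unique[of "\<lambda>m. X m $$ (i,j)"]) (auto simp: mat_tendsto_def)
qed (use assms in \<open>auto simp: mat_tendsto_def\<close>)

text \<open>Bolzano-Weierstrass for one index at a time: each new index thins the subsequence
  further, which keeps the limits already obtained.\<close>

lemma bounded_family_convergent_subsequence:
  fixes X :: "nat \<Rightarrow> 'i \<Rightarrow> complex"
  assumes "finite I" "\<And>i. i \<in> I \<Longrightarrow> bounded (range (\<lambda>m. X m i))"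
  shows "\<exists>r f. strict_mono r \<and> (\<forall>i\<in>I. (\<lambda>m. X (r m) i) \<longlonglongrightarrow> f i)"
  using assms
proof (induction I rule: finite_induct)
  case empty
  show ?case by (auto intro: exI[of _ id] simp: strict_mono_def)
next
  case (insert i I)
  then obtain r f where r: "strict_mono r" and f: "\<forall>i\<in>I. (\<lambda>m. X (r m) i) \<longlonglongrightarrow> f i" by auto
  have "bounded (range (\<lambda>m. X (r m) i))"
    using insert.prems[of i] by (auto intro: bounded_subset)
  then obtain l s where s: "strict_mono s" and l: "((\<lambda>m. X (r m) i) \<circ> s) \<longlonglongrightarrow> l"
    using bounded_imp_convergent_subsequence by blast
  have "(\<lambda>m. X ((r \<circ> s) m) j) \<longlonglongrightarrow> (f(i := l)) j" if "j \<in> insert i I" for j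
    using that l LIMSEQ_subseq_LIMSEQ[OF _ s, of "\<lambda>m. X (r m) j"] f by (auto simp: o_def)
  then show ?case using strict_mono_o[OF r s] by blast
qed

lemma bounded_mat_subsequence:
  fixes X :: "nat \<Rightarrow> complex mat"
  assumes c: "\<And>m. X m \<in> carrier_mat n n"
    and b: "\<And>i j. i < n \<Longrightarrow> j < n \<Longrightarrow> bounded (range (\<lambda>m. X m $$ (i,j)))"
  shows "\<exists>r L. strict_mono r \<and> mat_tendsto n (\<lambda>m. X (r m)) L"
proof -
  obtain r f where r: "strict_mono r"
    and f: "\<forall>p\<in>{..<n}\<times>{..<n}. (\<lambda>m. X (r m) $$ p) \<longlonglongrightarrow> f p"
    using bounded_family_convergent_subsequence[of "{..<n}\<times>{..<n}" "\<lambda>m p. X m $$ p"] b by auto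
  have "mat_tendsto n (\<lambda>m. X (r m)) (mat n n f)"
    using c f by (auto simp: mat_tendsto_def)
  then show ?thesis using r by blast
qed

section \<open>Closedness of subspaces and their coordinate projections\<close>

text \<open>The restriction of S to I is a subspace of the finite-dimensional space C^I, hence
  closed. The induction is Gaussian elimination. Elements of S are functions on the whole index
  type, so S may be kept or cut down while I shrinks.\<close>

lemma subspace_closed_on_finite:
  fixes X :: "nat \<Rightarrow> 'i \<Rightarrow> complex" and f :: "'i \<Rightarrow> complex"
  assumes "finite I"
    and "\<And>s t. s \<in> S \<Longrightarrow> t \<in> S \<Longrightarrow> (\<lambda>i. s i + t i) \<in> S"
    and "\<And>c s. s \<in> S \<Longrightarrow> (\<lambda>i. c * s i) \<in> S"
    and "\<And>m. X m \<in> S" and "\<And>i. i \<in> I \<Longrightarrow> (\<lambda>m. X m i) \<longlonglongrightarrow> f i"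
  shows "\<exists>s\<in>S. \<forall>i\<in>I. s i = f i"
  using assms
proof (induction I arbitrary: S X f rule: finite_induct)
  case empty
  then show ?case by blast
next
  case (insert i I)
  note add = insert.prems(1) and scale = insert.prems(2) and X = insert.prems(3) and lim = insert.prems(4)
  show ?case
  proof (cases "\<forall>s\<in>S. s i = 0")
    case True
    have "(\<lambda>m. X m i) = (\<lambda>_. 0)" using X True by auto
    then have "f i = 0" using lim[of i] by (simp add: LIMSEQ_const_iff)
    moreover obtain s where "s \<in> S" "\<forall>j\<in>I. s j = f j"
      using insert.IH[of S X f] add scale X lim by blast
    ultimately show ?thesis using True by auto
  next
    case False
    then obtain e0 where e0: "e0 \<in> S" "e0 i \<noteq> 0" by blast
    \<comment> \<open>A pivot vector, normalised to the value 1 at i.\<close>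
    define e where "e = (\<lambda>j. inverse (e0 i) * e0 j)"
    have e: "e \<in> S" "e i = 1" using e0 scale by (auto simp: e_def)
    define S0 where "S0 = {s \<in> S. s i = 0}"
    \<comment> \<open>Subtracting the multiple of the pivot that clears coordinate i moves the
      sequence into S0, where the induction hypothesis applies; adding \<open>f i\<close> times the
      pivot afterwards restores the right limit at i.\<close>
    define Y where "Y m j = X m j + (- X m i) * e j" for m j
    have "Y m \<in> S0" for m
      using add[OF X[of m] scale[OF e(1), of "- X m i"]] e(2) by (auto simp: S0_def Y_def[abs_def])
    moreover have "(\<lambda>m. Y m j) \<longlonglongrightarrow> f j + (- f i) * e j" if "j \<in> I" for j
      unfolding Y_def using lim that by (intro tendsto_intros) auto
    ultimately obtain s where s: "s \<in> S0" "\<forall>j\<in>I. s j = f j + (- f i) * e j"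
      using insert.IH[of S0 Y "\<lambda>j. f j + (- f i) * e j"] add scale by (auto simp: S0_def)
    have "(\<lambda>j. s j + f i * e j) \<in> S" using s(1) add scale e by (auto simp: S0_def)
    then show ?thesis using s e by (intro bexI[of _ "\<lambda>j. s j + f i * e j"]) (auto simp: S0_def)
  qed
qed

text \<open>Projecting A to the entries in I gives a subspace of C^I, and that is closed. Nothing is
  asked of the entries of X outside I, which may be unbounded.\<close>

lemma subalgebra_entries_closed:
  fixes X :: "nat \<Rightarrow> complex mat"
  assumes A: "unital_subalgebra n A" and X: "\<And>m. X m \<in> A" and I: "I \<subseteq> {..<n} \<times> {..<n}"
    and lim: "\<And>p. p \<in> I \<Longrightarrow> (\<lambda>m. X m $$ p) \<longlonglongrightarrow> f p"
  shows "\<exists>a\<in>A. \<forall>p\<in>I. a $$ p = f p"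
proof -
  \<comment> \<open>Agreement is required on the n by n index square only, since \<open>$$\<close>
    is not controlled outside the dimensions and sums would not be respected there.\<close>
  define S where "S = {s. \<exists>a\<in>A. \<forall>p\<in>{..<n}\<times>{..<n}. s p = a $$ p}"
  have "\<exists>s\<in>S. \<forall>p\<in>I. s p = f p"
  proof (rule subspace_closed_on_finite[of _ _ "\<lambda>m p. X m $$ p"])
    show "finite I" using I by (rule finite_subset) auto
    show "(\<lambda>p. s p + t p) \<in> S" if "s \<in> S" "t \<in> S" for s t
    proof -
      from that obtain a b where ab: "a \<in> A" "b \<in> A" "\<forall>p\<in>{..<n}\<times>{..<n}. s p = a $$ p"
        "\<forall>p\<in>{..<n}\<times>{..<n}. t p = b $$ p" by (auto simp: S_def)
      then have "a \<in> carrier_mat n n" "b \<in> carrier_mat n n" "a + b \<in> A"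
        using A by (auto simp: unital_subalgebra_def)
      then show ?thesis using ab unfolding S_def by (intro CollectI bexI[of _ "a + b"]) auto
    qed
    show "(\<lambda>p. c * s p) \<in> S" if "s \<in> S" for c s
    proof -
      from that obtain a where a: "a \<in> A" "\<forall>p\<in>{..<n}\<times>{..<n}. s p = a $$ p" by (auto simp: S_def)
      then have "a \<in> carrier_mat n n" "c \<cdot>\<^sub>m a \<in> A" using A by (auto simp: unital_subalgebra_def)
      then show ?thesis using a unfolding S_def by (intro CollectI bexI[of _ "c \<cdot>\<^sub>m a"]) auto
    qed
    show "(\<lambda>p. X m $$ p) \<in> S" for m using X unfolding S_def by auto
  qed (use lim in auto)
  then obtain s a where "a \<in> A" "\<forall>p\<in>I. s p = f p" "\<forall>p\<in>{..<n}\<times>{..<n}. s p = a $$ p"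
    unfolding S_def by blast
  then show ?thesis using I by (intro bexI[of _ a]) fastforce+
qed

lemma subalgebra_closed:
  fixes X :: "nat \<Rightarrow> complex mat"
  assumes A: "unital_subalgebra n A" and X: "\<And>m. X m \<in> A" and lim: "mat_tendsto n X L"
  shows "L \<in> A"
proof -
  obtain a where a: "a \<in> A" "\<forall>p\<in>{..<n}\<times>{..<n}. a $$ p = L $$ p"
    using subalgebra_entries_closed[OF A, of X "{..<n}\<times>{..<n}" "\<lambda>p. L $$ p"] X lim
    by (auto simp: mat_tendsto_def)
  have "a \<in> carrier_mat n n" using a A by (auto simp: unital_subalgebra_def)
  then have "a = L" using a(2) lim by (intro eq_matI) (auto simp: mat_tendsto_def)
  then show ?thesis using a by simp
qed

section \<open>A matrix norm and asymptotically unitary sequences\<close>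

text \<open>Any submultiplicative norm dominating the entries would serve; this one has an
  elementary proof of both properties.\<close>

definition l1_mat :: "nat \<Rightarrow> complex mat \<Rightarrow> real" where
  "l1_mat n M = (\<Sum>i<n. \<Sum>j<n. cmod (M $$ (i,j)))"

lemma entry_le_l1_mat:
  assumes "i < n" "j < n"
  shows "cmod (M $$ (i,j)) \<le> l1_mat n M"
proof -
  have "cmod (M $$ (i,j)) \<le> (\<Sum>j<n. cmod (M $$ (i,j)))"
    using assms by (intro member_le_sum) auto
  also have "\<dots> \<le> l1_mat n M"
    unfolding l1_mat_def using assms
    by (intro member_le_sum[of i "{..<n}" "\<lambda>i. \<Sum>j<n. cmod (M $$ (i,j))"]) (auto intro: sum_nonneg)
  finally show ?thesis .
qed

lemma l1_mat_nonneg: "0 \<le> l1_mat n M"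
  by (auto simp: l1_mat_def intro!: sum_nonneg)

lemma l1_mat_mult:
  assumes "A \<in> carrier_mat n n" "B \<in> carrier_mat n n"
  shows "l1_mat n (A * B) \<le> l1_mat n A * l1_mat n B"
proof -
  have "l1_mat n (A * B) \<le> (\<Sum>i<n. \<Sum>j<n. \<Sum>k<n. cmod (A $$ (i,k)) * cmod (B $$ (k,j)))"
    unfolding l1_mat_def using assms
    by (intro sum_mono) (auto simp: mult_entry[of _ n] norm_mult intro!: sum_norm_le simp del: index_mult_mat(1))
  also have "\<dots> = (\<Sum>i<n. \<Sum>k<n. \<Sum>j<n. cmod (A $$ (i,k)) * cmod (B $$ (k,j)))"
    by (intro sum.cong refl sum.swap)
  also have "\<dots> = (\<Sum>i<n. \<Sum>k<n. cmod (A $$ (i,k)) * (\<Sum>j<n. cmod (B $$ (k,j))))"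
    by (simp add: sum_distrib_left)
  also have "\<dots> \<le> (\<Sum>i<n. \<Sum>k<n. cmod (A $$ (i,k)) * l1_mat n B)"
  proof (intro sum_mono mult_left_mono)
    fix k assume "k \<in> {..<n}"
    then show "(\<Sum>j<n. cmod (B $$ (k,j))) \<le> l1_mat n B"
      unfolding l1_mat_def
      by (intro member_le_sum[of k "{..<n}" "\<lambda>k. \<Sum>j<n. cmod (B $$ (k,j))"]) (auto intro: sum_nonneg)
  qed auto
  also have "\<dots> = l1_mat n A * l1_mat n B"
    by (simp add: l1_mat_def sum_distrib_right)
  finally show ?thesis .
qed

lemma l1_mat_triangle:
  assumes "A \<in> carrier_mat n n" "B \<in> carrier_mat n n"
  shows "l1_mat n (A - B) \<le> l1_mat n A + l1_mat n B"
  unfolding l1_mat_def sum.distrib[symmetric] using assms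
  by (intro sum_mono) (auto intro: norm_triangle_ineq4)

lemma l1_mat_tendsto:
  assumes "mat_tendsto n X L"
  shows "(\<lambda>m. l1_mat n (X m)) \<longlonglongrightarrow> l1_mat n L"
  using assms unfolding l1_mat_def mat_tendsto_def by (intro tendsto_sum tendsto_norm) auto

text \<open>If c is almost isometric, its inverse w = c* - (c*c - 1) w is close to its adjoint.\<close>
lemma asymptotic_unitary_inverse:
  assumes c: "mat_tendsto n c v" and w: "\<And>m. w m \<in> carrier_mat n n"
    and cw: "\<And>m. c m * w m = 1\<^sub>m n" and v: "adj v * v = 1\<^sub>m n"
  shows "mat_tendsto n w (adj v)"
proof -
  have cc: "\<And>m. c m \<in> carrier_mat n n" and vc: "v \<in> carrier_mat n n"
    using c by (auto simp: mat_tendsto_def)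
  define E where "E m = adj (c m) * c m - 1\<^sub>m n" for m
  have Ec: "E m \<in> carrier_mat n n" for m unfolding E_def by (rule minus_carrier_mat) simp
  have "mat_tendsto n (\<lambda>m. adj (c m) * c m) (1\<^sub>m n)"
    using mat_tendsto_mult[OF mat_tendsto_adj[OF c] c] v by simp
  then have "mat_tendsto n E (0\<^sub>m n n)"
    using cc unfolding E_def
    by (auto simp: mat_tendsto_def LIM_zero_iff simp del: index_mult_mat(1) split: if_splits
        intro: LIM_zero tendsto_eq_intros)
  then have E0: "(\<lambda>m. l1_mat n (E m)) \<longlonglongrightarrow> 0"
    using l1_mat_tendsto[of n E "0\<^sub>m n n"] by (simp add: l1_mat_def)
  have w_eq: "w m = adj (c m) - E m * w m" for m
  proof -
    have "E m * w m = (adj (c m) * c m) * w m - 1\<^sub>m n * w m"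
      unfolding E_def using cc w by (intro minus_mult_distrib_mat[of _ n n _ _ n]) auto
    also have "(adj (c m) * c m) * w m = adj (c m)"
      using cc[of m] w[of m] cw[of m] by (simp add: assoc_mult_mat[of _ n n _ n _ n])
    finally show ?thesis using w[of m] cc[of m]
      by (intro eq_matI) (auto simp del: index_mult_mat(1))
  qed
  have ca: "mat_tendsto n (\<lambda>m. adj (c m)) (adj v)" by (rule mat_tendsto_adj[OF c])
  have C: "(\<lambda>m. l1_mat n (adj (c m))) \<longlonglongrightarrow> l1_mat n (adj v)"
    by (rule l1_mat_tendsto[OF ca])
  \<comment> \<open>No bound on w is given in advance. Once the norm of \<open>E m\<close> is below
    1/2, the term \<open>E m * w m\<close> in \<open>w_eq\<close> costs at most half the norm of w
    and is absorbed, which bounds w by twice the norm of \<open>adj (c m)\<close>.\<close>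
  have "\<forall>\<^sub>F m in sequentially. l1_mat n (E m) < 1/2"
    using E0 by (rule order_tendstoD) simp
  then have ev: "\<forall>\<^sub>F m in sequentially. l1_mat n (E m * w m) \<le> l1_mat n (E m) * (2 * l1_mat n (adj (c m)))"
  proof eventually_elim
    case (elim m)
    have p: "l1_mat n (E m * w m) \<le> l1_mat n (E m) * l1_mat n (w m)"
      using Ec w by (rule l1_mat_mult)
    have "l1_mat n (w m) \<le> l1_mat n (adj (c m)) + l1_mat n (E m * w m)"
      using l1_mat_triangle[of "adj (c m)" n "E m * w m"] cc Ec w w_eq[of m] by simp
    also have "\<dots> \<le> l1_mat n (adj (c m)) + 1/2 * l1_mat n (w m)"
      using p elim mult_right_mono[of "l1_mat n (E m)" "1/2" "l1_mat n (w m)"] l1_mat_nonneg[of n "w m"]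
      by linarith
    finally have "l1_mat n (w m) \<le> 2 * l1_mat n (adj (c m))" by simp
    then show ?case using p mult_left_mono[OF _ l1_mat_nonneg[of n "E m"]] by (meson order_trans)
  qed
  have "(\<lambda>m. l1_mat n (E m) * (2 * l1_mat n (adj (c m)))) \<longlonglongrightarrow> 0 * (2 * l1_mat n (adj v))"
    by (intro tendsto_mult E0 C tendsto_const)
  then have lim0: "(\<lambda>m. l1_mat n (E m) * (2 * l1_mat n (adj (c m)))) \<longlonglongrightarrow> 0" by simp
  have "(\<lambda>m. w m $$ (i,j)) \<longlonglongrightarrow> adj v $$ (i,j)" if ij: "i < n" "j < n" for i j
  proof -
    have "(\<lambda>m. (E m * w m) $$ (i,j)) \<longlonglongrightarrow> 0"
    proof (rule tendsto_0_le[OF lim0, where K = 1])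
      show "\<forall>\<^sub>F m in sequentially. cmod ((E m * w m) $$ (i,j))
          \<le> norm (l1_mat n (E m) * (2 * l1_mat n (adj (c m)))) * 1"
        using ev
      proof eventually_elim
        case (elim m)
        show ?case
          using elim entry_le_l1_mat[OF ij, of "E m * w m"] by (simp add: abs_if del: index_mult_mat(1))
      qed
    qed
    moreover have "(\<lambda>m. adj (c m) $$ (i,j)) \<longlonglongrightarrow> adj v $$ (i,j)"
      using ca ij by (simp add: mat_tendsto_def)
    ultimately have "(\<lambda>m. adj (c m) $$ (i,j) - (E m * w m) $$ (i,j)) \<longlonglongrightarrow> adj v $$ (i,j) - 0"
      by (intro tendsto_diff)
    moreover have "w m $$ (i,j) = adj (c m) $$ (i,j) - (E m * w m) $$ (i,j)" for m
    proof -
      have "w m $$ (i,j) = (adj (c m) - E m * w m) $$ (i,j)" using w_eq[of m] by simp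
      also have "\<dots> = adj (c m) $$ (i,j) - (E m * w m) $$ (i,j)"
        using ij Ec[of m] w[of m] by (intro index_minus_mat(1)) auto
      finally show ?thesis .
    qed
    ultimately show ?thesis by simp
  qed
  then show ?thesis using w vc by (simp add: mat_tendsto_def)
qed

text \<open>The j-th diagonal entry of the Gram matrix is the squared length of column j, so bounded
  Gram matrices force bounded entries.\<close>

lemma gram_diag_entry:
  assumes "c \<in> carrier_mat n n" "i < n" "j < n"
  shows "(cmod (c $$ (i,j)))\<^sup>2 \<le> cmod ((adj c * c) $$ (j,j))"
proof -
  have "(adj c * c) $$ (j,j) = complex_of_real (\<Sum>k<n. (cmod (c $$ (k,j)))\<^sup>2)"
    using assms by (simp add: mult_entry[of _ n] adj_entry complex_norm_square[symmetric] mult.commute[of "cnj _"]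
        del: index_mult_mat(1) of_real_power)
  then have "cmod ((adj c * c) $$ (j,j)) = (\<Sum>k<n. (cmod (c $$ (k,j)))\<^sup>2)"
    by (simp only: norm_of_real) (simp add: sum_nonneg)
  then show ?thesis using assms member_le_sum[of i "{..<n}" "\<lambda>k. (cmod (c $$ (k,j)))\<^sup>2"] by auto
qed

text \<open>The Gram matrices bound the columns, so a subsequence converges, and its limit has Gram
  matrix 1. With exactly unitary \<open>c m\<close> this is compactness of the unitary
  group.\<close>

lemma asymptotic_unitary_subsequence:
  assumes c: "\<And>m. c m \<in> carrier_mat n n" and lim: "mat_tendsto n (\<lambda>m. adj (c m) * c m) (1\<^sub>m n)"
  shows "\<exists>r v. strict_mono r \<and> unitary_n n v \<and> mat_tendsto n (\<lambda>m. c (r m)) v"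
proof -
  have "bounded (range (\<lambda>m. c m $$ (i,j)))" if "i < n" "j < n" for i j
  proof -
    have "Bseq (\<lambda>m. (adj (c m) * c m) $$ (j,j))"
      using lim that by (intro convergent_imp_Bseq convergentI) (auto simp: mat_tendsto_def)
    then obtain K where K: "\<And>m. cmod ((adj (c m) * c m) $$ (j,j)) \<le> K" by (auto simp: Bseq_def)
    have "cmod (c m $$ (i,j)) \<le> sqrt K" for m
      using gram_diag_entry[OF c[of m] that] K[of m] by (intro real_le_rsqrt) auto
    then show ?thesis by (auto simp: bounded_iff)
  qed
  then obtain r v where r: "strict_mono r" and v: "mat_tendsto n (\<lambda>m. c (r m)) v"
    using bounded_mat_subsequence[of c n] c by blast
  have "adj v * v = 1\<^sub>m n"
    using mat_tendsto_mult[OF mat_tendsto_adj[OF v] v] mat_tendsto_subseq[OF lim r]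
    by (rule mat_tendsto_unique)
  then have "unitary_n n v" using v by (intro unitary_nI) (auto simp: mat_tendsto_def)
  then show ?thesis using r v by blast
qed

section \<open>Exact factorization from density\<close>

text \<open>With a = \<open>v * R\<close> this says R = \<open>adj v * a\<close>; the second
  membership says that the inverse of a lies in A too. The inverse of R is quantified as
  \<open>R'\<close> so that it can be used directly in products.\<close>

definition unitary_factorization :: "nat \<Rightarrow> complex mat set \<Rightarrow> bool" where
  "unitary_factorization n A \<longleftrightarrow> (\<forall>R R'. R \<in> carrier_mat n n \<longrightarrow> R' \<in> carrier_mat n n \<longrightarrow>
     R * R' = 1\<^sub>m n \<longrightarrow> R' * R = 1\<^sub>m n \<longrightarrow> (\<exists>v. unitary_n n v \<and> v * R \<in> A \<and> R' * adj v \<in> A))"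

text \<open>If the Gram matrices of invertible elements a of A tend to that of R, then those of
  \<open>a * R'\<close> tend to 1. A subsequence of \<open>a * R'\<close> therefore tends to a
  unitary v, hence a tends to \<open>v * R\<close>, and A is closed.\<close>

lemma logmodular_unitary_factorization:
  assumes A: "logmodular n A"
  shows "unitary_factorization n A"
  unfolding unitary_factorization_def
proof (intro allI impI)
  fix R R' :: "complex mat" assume R: "R \<in> carrier_mat n n" and R': "R' \<in> carrier_mat n n"
    and inv: "R * R' = 1\<^sub>m n" "R' * R = 1\<^sub>m n"
  have alg: "unital_subalgebra n A" using A by (simp add: logmodular_def)
  have Ac: "\<And>a. a \<in> A \<Longrightarrow> a \<in> carrier_mat n n" using alg by (auto simp: unital_subalgebra_def)
  have "\<forall>m. \<exists>a. invertible_in A a \<and>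
      (\<forall>i<n. \<forall>j<n. cmod ((adj a * a) $$ (i,j) - (adj R * R) $$ (i,j)) < 1 / real (Suc m))"
    using A pos_invertible_gram[OF R R' inv] by (auto simp: logmodular_def simp del: index_mult_mat(1))
  then obtain a where a: "\<And>m. invertible_in A (a m)"
    and approx: "\<And>m i j. i < n \<Longrightarrow> j < n \<Longrightarrow>
      cmod ((adj (a m) * a m) $$ (i,j) - (adj R * R) $$ (i,j)) < 1 / real (Suc m)"
    by metis
  have aA: "a m \<in> A" for m using a by (simp add: invertible_in_def)
  have ac: "a m \<in> carrier_mat n n" for m using aA Ac by blast
  have "\<forall>m. \<exists>b\<in>A. a m * b = 1\<^sub>m n \<and> b * a m = 1\<^sub>m n"
    using a ac by (metis carrier_matD(1) invertible_in_def)
  then obtain b where bA: "\<And>m. b m \<in> A" and ab: "\<And>m. a m * b m = 1\<^sub>m n" by metis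
  have bc: "b m \<in> carrier_mat n n" for m using bA Ac by blast
  have lim_a: "mat_tendsto n (\<lambda>m. adj (a m) * a m) (adj R * R)"
  proof -
    have "(\<lambda>m. (adj (a m) * a m) $$ (i,j)) \<longlonglongrightarrow> (adj R * R) $$ (i,j)" if "i < n" "j < n" for i j
    proof (rule LIM_zero_cancel, rule tendsto_0_le[OF lim_inverse_n, where K = 1])
      show "\<forall>\<^sub>F m in sequentially. cmod ((adj (a m) * a m) $$ (i,j) - (adj R * R) $$ (i,j))
          \<le> norm (inverse (real m)) * 1"
        using eventually_gt_at_top[of 0]
      proof eventually_elim
        case (elim m)
        have "1 / real (Suc m) \<le> inverse (real m)" using elim by (simp add: field_simps)
        then show ?case using approx[OF that, of m] by simp
      qed
    qed
    then show ?thesis using ac R by (simp add: mat_tendsto_def del: index_mult_mat(1))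
  qed
  define c where "c m = a m * R'" for m
  have cc: "c m \<in> carrier_mat n n" for m using ac R' by (simp add: c_def)
  have gram_c: "adj (c m) * c m = adj R' * ((adj (a m) * a m) * R')" for m
    using ac[of m] R' by (simp add: c_def adj_mult assoc_mult_mat[of _ n n _ n _ n])
  have "adj R' * ((adj R * R) * R') = 1\<^sub>m n"
  proof -
    have "adj R' * ((adj R * R) * R') = adj (R * R') * (R * R')"
      using R R' by (simp add: adj_mult assoc_mult_mat[of _ n n _ n _ n])
    also have "\<dots> = 1\<^sub>m n" using inv by simp (auto simp: adj_def intro!: eq_matI)
    finally show ?thesis .
  qed
  then have "mat_tendsto n (\<lambda>m. adj (c m) * c m) (1\<^sub>m n)"
    unfolding gram_c
    using mat_tendsto_mult[OF mat_tendsto_const mat_tendsto_mult[OF lim_a mat_tendsto_const], of "adj R'" R'] R'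
    by simp
  then obtain r v where r: "strict_mono r" and v: "unitary_n n v"
    and lim: "mat_tendsto n (\<lambda>m. c (r m)) v"
    using asymptotic_unitary_subsequence[of c n] cc by blast
  \<comment> \<open>\<open>R * b (r m)\<close> is a right inverse of \<open>c (r m)\<close>, so it
    tends to the adjoint of the limit; multiplying by \<open>R'\<close> then recovers the inverses
    b, which lie in A.\<close>
  have "mat_tendsto n (\<lambda>m. R * b (r m)) (adj v)"
  proof (rule asymptotic_unitary_inverse[OF lim])
    fix m
    show "R * b (r m) \<in> carrier_mat n n" using R bc by simp
    have "c (r m) * (R * b (r m)) = a (r m) * b (r m)"
      unfolding c_def using ac R' R bc inv by (intro mult_cancel_mid) auto
    then show "c (r m) * (R * b (r m)) = 1\<^sub>m n" using ab by simp
  qed (use v in \<open>simp add: unitary_n_def\<close>)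
  then have "mat_tendsto n (\<lambda>m. R' * (R * b (r m))) (R' * adj v)"
    using R' by (intro mat_tendsto_mult mat_tendsto_const)
  moreover have "R' * (R * b m) = b m" for m
  proof -
    have "R' * (R * b m) = (R' * R) * b m" using R R' bc[of m] by simp
    then show ?thesis using inv bc[of m] by simp
  qed
  ultimately have "R' * adj v \<in> A"
    using subalgebra_closed[OF alg, of "\<lambda>m. b (r m)"] bA by simp
  moreover have "v * R \<in> A"
  proof -
    have "c m * R = a m" for m
      using ac[of m] R R' inv right_mult_one_mat[OF ac[of m]]
      by (simp add: c_def assoc_mult_mat[of _ n n _ n _ n] del: right_mult_one_mat)
    moreover have "mat_tendsto n (\<lambda>m. c (r m) * R) (v * R)"
      using R by (intro mat_tendsto_mult mat_tendsto_const lim)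
    ultimately show ?thesis using subalgebra_closed[OF alg, of "\<lambda>m. a (r m)"] aA by simp
  qed
  ultimately show "\<exists>v. unitary_n n v \<and> v * R \<in> A \<and> R' * adj v \<in> A" using v by blast
qed

section \<open>Degeneration along powers of a diagonal matrix\<close>

lemma power_ratio_tendsto:
  assumes r: "strict_mono r" and "l \<le> k"
  shows "(\<lambda>m. complex_of_real (real (Suc (r m)) ^ l / real (Suc (r m)) ^ k)) \<longlonglongrightarrow> (if l = k then 1 else 0)"
proof (cases "l = k")
  case False
  then have lk: "l < k" using assms by simp
  have "(\<lambda>m. inverse (real (Suc m))) \<longlonglongrightarrow> 0" by (rule LIMSEQ_inverse_real_of_nat)
  then have "(\<lambda>m. inverse (real (Suc (r m)))) \<longlonglongrightarrow> 0"
    using LIMSEQ_subseq_LIMSEQ[OF _ r] by (auto simp: o_def)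
  then have "(\<lambda>m. inverse (real (Suc (r m))) ^ (k - l)) \<longlonglongrightarrow> 0 ^ (k - l)" by (rule tendsto_power)
  moreover have "inverse (real (Suc (r m))) ^ (k - l) = real (Suc (r m)) ^ l / real (Suc (r m)) ^ k" for m
    using lk by (simp add: power_diff power_inverse divide_simps del: of_nat_Suc)
  ultimately have "(\<lambda>m. real (Suc (r m)) ^ l / real (Suc (r m)) ^ k) \<longlonglongrightarrow> 0 ^ (k - l)" by (simp only:)
  then have "(\<lambda>m. real (Suc (r m)) ^ l / real (Suc (r m)) ^ k) \<longlonglongrightarrow> 0"
    using lk by (simp only: zero_power zero_less_diff)
  then have "(\<lambda>m. complex_of_real (real (Suc (r m)) ^ l / real (Suc (r m)) ^ k)) \<longlonglongrightarrow> of_real 0"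
    by (rule tendsto_of_real)
  then show ?thesis using False by simp
qed simp

text \<open>Here v is a limit point of the unitary factors of diag(1,t,t^2,...) as t tends to infinity, and
  the matrices found in A are v E(k,k) v*.\<close>
lemma exists_diagonalizing_unitary:
  assumes alg: "unital_subalgebra n A" and fact: "unitary_factorization n A"
  shows "\<exists>v. unitary_n n v \<and> (\<forall>k<n. mat n n (\<lambda>(i,j). v $$ (i,k) * cnj (v $$ (j,k))) \<in> A)"
proof -
  have Ac: "\<And>a. a \<in> A \<Longrightarrow> a \<in> carrier_mat n n" using alg by (auto simp: unital_subalgebra_def)
  define t where "t m = real (Suc m)" for m
  have t: "t m \<noteq> 0" for m by (simp add: t_def)
  define D where "D m = mat_diag n (\<lambda>i. complex_of_real (t m ^ i))" for m
  define D' where "D' m = mat_diag n (\<lambda>i. complex_of_real (inverse (t m ^ i)))" for m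
  have Dc: "D m \<in> carrier_mat n n" "D' m \<in> carrier_mat n n" for m by (simp_all add: D_def D'_def)
  have D_inv: "D m * D' m = 1\<^sub>m n" "D' m * D m = 1\<^sub>m n" for m
  proof -
    have "complex_of_real (t m ^ i) * complex_of_real (inverse (t m ^ i)) = 1" for i
      using t[of m] by (simp flip: of_real_mult)
    then show "D m * D' m = 1\<^sub>m n" "D' m * D m = 1\<^sub>m n"
      unfolding D_def D'_def mat_diag_diag by (simp_all only: mult.commute mat_diag_one)
  qed
  have "\<forall>m. \<exists>v. unitary_n n v \<and> v * D m \<in> A \<and> D' m * adj v \<in> A"
    using fact Dc D_inv unfolding unitary_factorization_def by blast
  then obtain u where u: "\<And>m. unitary_n n (u m)" and uD: "\<And>m. u m * D m \<in> A"
    and Du: "\<And>m. D' m * adj (u m) \<in> A" by metis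
  have uc: "u m \<in> carrier_mat n n" for m using u by (rule unitary_carrier)
  have "mat_tendsto n (\<lambda>m. adj (u m) * u m) (1\<^sub>m n)"
    using u by (simp add: unitary_n_def mat_tendsto_const)
  then obtain r v where r: "strict_mono r" and v: "unitary_n n v"
    and lim: "mat_tendsto n (\<lambda>m. u (r m)) v"
    using asymptotic_unitary_subsequence[of u n] uc by blast
  have vc: "v \<in> carrier_mat n n" using v by (rule unitary_carrier)
  have lime: "(\<lambda>m. u (r m) $$ (i,j)) \<longlonglongrightarrow> v $$ (i,j)" if "i < n" "j < n" for i j
    using lim that by (simp add: mat_tendsto_def)
  have "mat n n (\<lambda>(i,j). v $$ (i,k) * cnj (v $$ (j,k))) \<in> A" if k: "k < n" for k
  proof -
    \<comment> \<open>In the limit the rows of X with index above k vanish; those with index below k may blow up,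
      so only the projection of A to the remaining rows is used.\<close>
    define X where "X m = complex_of_real (t (r m) ^ k) \<cdot>\<^sub>m (D' (r m) * adj (u (r m)))" for m
    have XA: "X m \<in> A" for m using alg Du by (simp add: X_def unital_subalgebra_def)
    have X_entry: "X m $$ (i,j) = complex_of_real (t (r m) ^ k / t (r m) ^ i) * cnj (u (r m) $$ (j,i))"
      if "i < n" "j < n" for m i j
      using that uc[of "r m"] unfolding X_def D'_def
      by (subst mat_diag_mult_left[of _ n n]) (simp_all add: adj_entry[of _ n] divide_inverse)
    have "\<exists>b\<in>A. \<forall>p\<in>{k..<n} \<times> {..<n}. b $$ p = (case p of (i,j) \<Rightarrow> if k = i then cnj (v $$ (j,k)) else 0)"
    proof (rule subalgebra_entries_closed[OF alg, of X])
      show "X m \<in> A" for m by (rule XA)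
      fix p assume "p \<in> {k..<n} \<times> {..<n}"
      then obtain i j where p: "p = (i,j)" "k \<le> i" "i < n" "j < n" by auto
      have "(\<lambda>m. complex_of_real (t (r m) ^ k / t (r m) ^ i) * cnj (u (r m) $$ (j,i)))
          \<longlonglongrightarrow> (if k = i then 1 else 0) * cnj (v $$ (j,i))"
        using p unfolding t_def by (intro tendsto_mult tendsto_cnj lime power_ratio_tendsto[OF r]) auto
      then show "(\<lambda>m. X m $$ p) \<longlonglongrightarrow> (case p of (i,j) \<Rightarrow> if k = i then cnj (v $$ (j,k)) else 0)"
        using p by (auto simp: X_entry)
    qed auto
    then obtain b where bA: "b \<in> A"
      and b: "\<And>i j. k \<le> i \<Longrightarrow> i < n \<Longrightarrow> j < n \<Longrightarrow> b $$ (i,j) = (if k = i then cnj (v $$ (j,k)) else 0)"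
      by fastforce
    have bc: "b \<in> carrier_mat n n" using bA Ac by blast
    \<comment> \<open>The factor D weights row l of b by t^(l-k) after rescaling. Rows below index k
      are suppressed whatever their entries, row k keeps weight 1, and rows above k, whose weights
      explode, are zero in b by construction. Only E(k,k) b, which equals E(k,k) times
      \<open>adj v\<close>, survives.\<close>
    define Y where "Y m = complex_of_real (inverse (t (r m) ^ k)) \<cdot>\<^sub>m (u (r m) * D (r m) * b)" for m
    have YA: "Y m \<in> A" for m
      using alg uD bA by (simp add: Y_def unital_subalgebra_def del: assoc_mult_mat)
    have Y_entry: "Y m $$ (i,j) = (\<Sum>l<n. complex_of_real (t (r m) ^ l / t (r m) ^ k) * u (r m) $$ (i,l) * b $$ (l,j))"
      if "i < n" "j < n" for m i j
    proof -
      have uDl: "(u (r m) * D (r m)) $$ (i,l) = u (r m) $$ (i,l) * complex_of_real (t (r m) ^ l)" if "l < n" for l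
        using that \<open>i < n\<close> uc[of "r m"] unfolding D_def by (subst mat_diag_mult_right[of _ n n]) simp_all
      have "Y m $$ (i,j) = complex_of_real (inverse (t (r m) ^ k)) * (u (r m) * D (r m) * b) $$ (i,j)"
        using that uc[of "r m"] bc by (simp add: Y_def del: assoc_mult_mat index_mult_mat(1))
      also have "(u (r m) * D (r m) * b) $$ (i,j) = (\<Sum>l<n. u (r m) $$ (i,l) * complex_of_real (t (r m) ^ l) * b $$ (l,j))"
        using that uc[of "r m"] Dc bc
        by (subst mult_entry[of _ n]) (auto simp: uDl simp del: index_mult_mat(1))
      finally show ?thesis by (simp add: sum_distrib_left divide_inverse mult_ac)
    qed
    have "mat_tendsto n Y (mat n n (\<lambda>(i,j). v $$ (i,k) * cnj (v $$ (j,k))))"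
      unfolding mat_tendsto_def
    proof (intro conjI allI impI)
      fix i j assume ij: "i < n" "j < n"
      have "(\<lambda>m. \<Sum>l<n. complex_of_real (t (r m) ^ l / t (r m) ^ k) * u (r m) $$ (i,l) * b $$ (l,j))
          \<longlonglongrightarrow> (\<Sum>l<n. if l = k then v $$ (i,k) * cnj (v $$ (j,k)) else 0)"
      proof (rule tendsto_sum)
        fix l assume l: "l \<in> {..<n}"
        show "(\<lambda>m. complex_of_real (t (r m) ^ l / t (r m) ^ k) * u (r m) $$ (i,l) * b $$ (l,j))
          \<longlonglongrightarrow> (if l = k then v $$ (i,k) * cnj (v $$ (j,k)) else 0)"
        proof (cases "l \<le> k")
          case True
          have "(\<lambda>m. complex_of_real (t (r m) ^ l / t (r m) ^ k) * u (r m) $$ (i,l) * b $$ (l,j))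
            \<longlonglongrightarrow> (if l = k then 1 else 0) * v $$ (i,l) * b $$ (l,j)"
            using True l ij unfolding t_def
            by (intro tendsto_mult tendsto_const lime power_ratio_tendsto[OF r]) auto
          then show ?thesis using b[of l j] l ij by (cases "l = k") simp_all
        next
          case False
          then show ?thesis using b[of l j] l ij by auto
        qed
      qed
      then show "(\<lambda>m. Y m $$ (i,j)) \<longlonglongrightarrow> mat n n (\<lambda>(i,j). v $$ (i,k) * cnj (v $$ (j,k))) $$ (i,j)"
        using ij k by (simp add: Y_entry)
    qed (use YA Ac in auto)
    then show ?thesis using subalgebra_closed[OF alg] YA by blast
  qed
  then show ?thesis using v by blast
qed

section \<open>Transport along a unitary conjugation\<close>

lemma conj_mult:
  assumes "A \<in> carrier_mat n n" "B \<in> carrier_mat n n" "V \<in> carrier_mat n n" "V' \<in> carrier_mat n n"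
    and "V' * V = 1\<^sub>m n"
  shows "(V * A * V') * (V * B * V') = V * (A * B) * (V' :: complex mat)"
proof -
  have "(V * A * V') * (V * B * V') = (V * A * V') * (V * (B * V'))"
    using assms by (simp add: assoc_mult_mat[of _ n n _ n _ n])
  also have "\<dots> = (V * A) * (B * V')"
    by (rule mult_cancel_mid) (use assms in simp_all)
  also have "\<dots> = V * (A * B) * V'"
    using assms by (simp add: assoc_mult_mat[of _ n n _ n _ n])
  finally show ?thesis .
qed

lemma unital_subalgebra_conj:
  assumes alg: "unital_subalgebra n A" and v: "unitary_n n v"
  shows "unital_subalgebra n ((\<lambda>a. adj v * a * v) ` A)"
proof -
  have vc: "v \<in> carrier_mat n n" "adj v \<in> carrier_mat n n" using v by (auto simp: unitary_n_def)
  have Ac: "\<And>a. a \<in> A \<Longrightarrow> a \<in> carrier_mat n n" using alg by (auto simp: unital_subalgebra_def)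
  let ?c = "\<lambda>a. adj v * a * v"
  have one: "?c (1\<^sub>m n) = 1\<^sub>m n" using v vc by (simp add: unitary_n_def)
  have add: "?c a + ?c b = ?c (a + b)" if "a \<in> A" "b \<in> A" for a b
    using Ac[OF that(1)] Ac[OF that(2)] vc
    by (simp add: mult_add_distrib_mat[of _ n n _ n] add_mult_distrib_mat[of _ n n _ _ n] del: assoc_mult_mat)
  have mult: "?c a * ?c b = ?c (a * b)" if "a \<in> A" "b \<in> A" for a b
    using conj_mult[of a n b "adj v" v] Ac that vc v by (simp add: unitary_n_def)
  have smult: "z \<cdot>\<^sub>m ?c a = ?c (z \<cdot>\<^sub>m a)" if "a \<in> A" for a z
    using Ac[OF that] vc
    by (simp add: mult_smult_distrib[of _ n n _ n] mult_smult_assoc_mat[of _ n n _ n] del: assoc_mult_mat)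
  show ?thesis
    unfolding unital_subalgebra_def
  proof (intro conjI ballI allI)
    show "?c ` A \<subseteq> carrier_mat n n" using Ac vc by auto
    show "1\<^sub>m n \<in> ?c ` A" using alg one by (auto simp: unital_subalgebra_def intro!: image_eqI[of _ _ "1\<^sub>m n"])
    fix x assume "x \<in> ?c ` A"
    then obtain a where a: "a \<in> A" "x = ?c a" by blast
    show "z \<cdot>\<^sub>m x \<in> ?c ` A" for z using alg a smult by (auto simp: unital_subalgebra_def)
    fix y assume "y \<in> ?c ` A"
    then obtain b where b: "b \<in> A" "y = ?c b" by blast
    show "x + y \<in> ?c ` A" using alg a b add by (auto simp: unital_subalgebra_def)
    show "x * y \<in> ?c ` A" using alg a b mult by (auto simp: unital_subalgebra_def simp del: assoc_mult_mat)
  qed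
qed

text \<open>Factor \<open>R * adj v\<close>, whose inverse is \<open>v * R'\<close>, with respect to
  A. If u is its unitary factor, then \<open>adj v * u\<close> is one for R with respect to the
  conjugated algebra.\<close>

lemma unitary_factorization_conj:
  assumes fact: "unitary_factorization n A" and v: "unitary_n n v"
  shows "unitary_factorization n ((\<lambda>a. adj v * a * v) ` A)"
  unfolding unitary_factorization_def
proof (intro allI impI)
  fix R R' :: "complex mat"
  assume R: "R \<in> carrier_mat n n" and R': "R' \<in> carrier_mat n n"
    and inv: "R * R' = 1\<^sub>m n" "R' * R = 1\<^sub>m n"
  have vc: "v \<in> carrier_mat n n" "adj v \<in> carrier_mat n n" using v by (auto simp: unitary_n_def)
  have vv: "v * adj v = 1\<^sub>m n" "adj v * v = 1\<^sub>m n" using v by (auto simp: unitary_n_def)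
  have "(R * adj v) * (v * R') = 1\<^sub>m n"
    using mult_cancel_mid[of R n "adj v" v R'] R R' vc vv inv by simp
  moreover have "(v * R') * (R * adj v) = 1\<^sub>m n"
    using mult_cancel_mid[of v n R' R "adj v"] R R' vc vv inv by simp
  ultimately obtain u where u: "unitary_n n u" and m: "u * (R * adj v) \<in> A" "v * R' * adj u \<in> A"
    using fact R R' vc unfolding unitary_factorization_def by (metis mult_square_carrier)
  have uc: "u \<in> carrier_mat n n" "adj u \<in> carrier_mat n n" using u by (auto simp: unitary_n_def)
  have "(adj v * u) * R = adj v * (u * (R * adj v)) * v"
    using uc vc R vv by (simp add: assoc_mult_mat[of _ n n _ n _ n])
  moreover have "R' * adj (adj v * u) = adj v * (v * R' * adj u) * v"
  proof -
    have "adj v * (v * R' * adj u) * v = (1\<^sub>m n * (adj v)) * (v * (R' * (adj u * v)))"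
      using uc vc R' by (simp add: assoc_mult_mat[of _ n n _ n _ n])
    also have "\<dots> = 1\<^sub>m n * (R' * (adj u * v))"
      by (rule mult_cancel_mid) (use uc vc R' vv in simp_all)
    finally show ?thesis using uc vc R' by (simp add: adj_mult[of _ n] del: assoc_mult_mat)
  qed
  ultimately show "\<exists>w. unitary_n n w \<and> w * R \<in> (\<lambda>a. adj v * a * v) ` A \<and> R' * adj w \<in> (\<lambda>a. adj v * a * v) ` A"
    using m unitary_mult[OF unitary_adj[OF v] u] by blast
qed

section \<open>Algebras containing the diagonal matrices\<close>

definition mat_unit :: "nat \<Rightarrow> nat \<Rightarrow> nat \<Rightarrow> complex mat" where
  "mat_unit n p q = mat n n (\<lambda>ij. if ij = (p,q) then 1 else 0)"

lemma mat_unit_carrier [simp]: "mat_unit n p q \<in> carrier_mat n n"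
  by (simp add: mat_unit_def)

lemma mat_unit_mult:
  assumes "q < n"
  shows "mat_unit n p q * mat_unit n q s = mat_unit n p s"
proof (rule eq_matI)
  fix i j assume "i < dim_row (mat_unit n p s)" "j < dim_col (mat_unit n p s)"
  then have ij: "i < n" "j < n" by (auto simp: mat_unit_def)
  have "(mat_unit n p q * mat_unit n q s) $$ (i,j)
      = (\<Sum>k<n. if k = q then (if i = p \<and> j = s then 1 else 0) else 0)"
    by (rule trans[OF mult_entry[of _ n] sum.cong[OF refl]]) (use ij in \<open>auto simp: mat_unit_def\<close>)
  then show "(mat_unit n p q * mat_unit n q s) $$ (i,j) = mat_unit n p s $$ (i,j)"
    using ij assms by (simp add: mat_unit_def)
qed (auto simp: mat_unit_def)

locale diagonal_subalgebra =
  fixes n :: nat and B :: "complex mat set"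
  assumes alg: "unital_subalgebra n B"
    and diag: "k < n \<Longrightarrow> mat_unit n k k \<in> B"
begin

lemma carrier: "b \<in> B \<Longrightarrow> b \<in> carrier_mat n n"
  using alg by (auto simp: unital_subalgebra_def)

text \<open>Compressing b by the diagonal idempotents E(p,p) and E(q,q) isolates its (p,q) entry as
  a multiple of E(p,q).\<close>

lemma mat_unit_mem:
  assumes b: "b \<in> B" and pq: "p < n" "q < n" and nz: "b $$ (p,q) \<noteq> 0"
  shows "mat_unit n p q \<in> B"
proof -
  have bc: "b \<in> carrier_mat n n" using b by (rule carrier)
  have unit_diag: "mat_unit n k k = mat_diag n (\<lambda>i. if i = k then 1 else 0)" for k
    by (auto simp: mat_unit_def mat_diag_def intro!: eq_matI)
  have "mat_unit n p p * b * mat_unit n q q = b $$ (p,q) \<cdot>\<^sub>m mat_unit n p q"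
    unfolding unit_diag using pq bc
    by (subst mat_diag_mult_left[of _ n n], simp)
       (subst mat_diag_mult_right[of _ n n], auto simp: mat_unit_def intro!: eq_matI)
  then have "mat_unit n p q = (1 / b $$ (p,q)) \<cdot>\<^sub>m (mat_unit n p p * b * mat_unit n q q)"
    using nz by (auto simp: mat_unit_def intro!: eq_matI simp del: assoc_mult_mat)
  then show ?thesis using alg b diag pq by (simp add: unital_subalgebra_def del: assoc_mult_mat)
qed

text \<open>Together with \<open>diag\<close> this makes membership of E(p,q) in B a preorder on the
  coordinates.\<close>

lemma unit_trans: "q < n \<Longrightarrow> mat_unit n p q \<in> B \<Longrightarrow> mat_unit n q s \<in> B \<Longrightarrow> mat_unit n p s \<in> B"
  using alg mat_unit_mult[of q n p s] by (metis unital_subalgebra_def)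

text \<open>B is the incidence algebra of that preorder: membership depends only on where the
  entries are nonzero, since a matrix is the sum of its entries times matrix units.\<close>

lemma mem_iff:
  assumes M: "M \<in> carrier_mat n n"
  shows "M \<in> B \<longleftrightarrow> (\<forall>p<n. \<forall>q<n. M $$ (p,q) \<noteq> 0 \<longrightarrow> mat_unit n p q \<in> B)"
proof
  assume "M \<in> B"
  then show "\<forall>p<n. \<forall>q<n. M $$ (p,q) \<noteq> 0 \<longrightarrow> mat_unit n p q \<in> B" using mat_unit_mem by blast
next
  assume supp: "\<forall>p<n. \<forall>q<n. M $$ (p,q) \<noteq> 0 \<longrightarrow> mat_unit n p q \<in> B"
  have zero: "0\<^sub>m n n \<in> B"
  proof -
    have "0 \<cdot>\<^sub>m 1\<^sub>m n \<in> B" using alg by (auto simp: unital_subalgebra_def)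
    moreover have "(0::complex) \<cdot>\<^sub>m 1\<^sub>m n = 0\<^sub>m n n" by (auto intro!: eq_matI)
    ultimately show ?thesis by simp
  qed
  have "mat n n (\<lambda>ij. if ij \<in> I then M $$ ij else 0) \<in> B" if "finite I" "I \<subseteq> {..<n} \<times> {..<n}" for I
    using that
  proof (induction I rule: finite_induct)
    case empty
    have "mat n n (\<lambda>ij. if ij \<in> {} then M $$ ij else 0) = 0\<^sub>m n n" by (auto intro!: eq_matI)
    then show ?case using zero by simp
  next
    case (insert x I)
    obtain p q where x: "x = (p,q)" "p < n" "q < n" using insert.prems by auto
    have "mat n n (\<lambda>ij. if ij \<in> insert x I then M $$ ij else 0)
        = mat n n (\<lambda>ij. if ij \<in> I then M $$ ij else 0) + M $$ (p,q) \<cdot>\<^sub>m mat_unit n p q"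
      using x insert.hyps by (auto simp: mat_unit_def intro!: eq_matI)
    moreover have "M $$ (p,q) \<cdot>\<^sub>m mat_unit n p q \<in> B"
    proof (cases "M $$ (p,q) = 0")
      case True
      then have "M $$ (p,q) \<cdot>\<^sub>m mat_unit n p q = 0\<^sub>m n n" by (auto simp: mat_unit_def intro!: eq_matI)
      then show ?thesis using zero by simp
    next
      case False
      then show ?thesis using supp x alg by (auto simp: unital_subalgebra_def)
    qed
    ultimately show ?case using insert alg by (auto simp: unital_subalgebra_def)
  qed
  from this[of "{..<n} \<times> {..<n}"] have "mat n n (\<lambda>ij. if ij \<in> {..<n} \<times> {..<n} then M $$ ij else 0) \<in> B" by simp
  moreover have "mat n n (\<lambda>ij. if ij \<in> {..<n} \<times> {..<n} then M $$ ij else 0) = M"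
    using M by (intro eq_matI) auto
  ultimately show "M \<in> B" by simp
qed

text \<open>Factor the shear R = 1 + E(i,j) as w R in B and R^-1 w* in B. If i and j were incomparable,
  columns i and i + j of w would be orthogonal, as their supports meet only in common
  predecessors p, where membership of R^-1 w* forces the entries to vanish.\<close>
lemma unit_total:
  assumes fact: "unitary_factorization n B" and i: "i < n" and j: "j < n"
  shows "mat_unit n i j \<in> B \<or> mat_unit n j i \<in> B"
proof (rule ccontr)
  assume "\<not> ?thesis"
  then have nij: "mat_unit n i j \<notin> B" and nji: "mat_unit n j i \<notin> B" by auto
  have neq: "i \<noteq> j" using nij diag i by auto
  define R where "R = mat n n (\<lambda>(p,q). if p = q \<or> (p = i \<and> q = j) then 1 else 0 :: complex)"
  define R' where "R' = mat n n (\<lambda>(p,q). if p = q then 1 else if p = i \<and> q = j then - 1 else 0 :: complex)"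
  have Rc: "R \<in> carrier_mat n n" "R' \<in> carrier_mat n n" by (auto simp: R_def R'_def)
  have R_right: "(M * R) $$ (p,i) = M $$ (p,i)" "(M * R) $$ (p,j) = M $$ (p,i) + M $$ (p,j)"
    if "M \<in> carrier_mat n n" "p < n" for M p
  proof -
    have "(M * R) $$ (p,i) = (\<Sum>k<n. if k = i then M $$ (p,i) else 0)"
      by (rule trans[OF mult_entry[of _ n] sum.cong[OF refl]]) (use that i neq Rc in \<open>auto simp: R_def\<close>)
    then show "(M * R) $$ (p,i) = M $$ (p,i)" using i by simp
    have "(M * R) $$ (p,j) = (\<Sum>k<n. (if k = i then M $$ (p,i) else 0) + (if k = j then M $$ (p,j) else 0))"
      by (rule trans[OF mult_entry[of _ n] sum.cong[OF refl]]) (use that j neq Rc in \<open>auto simp: R_def\<close>)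
    then show "(M * R) $$ (p,j) = M $$ (p,i) + M $$ (p,j)" using i j by (simp add: sum.distrib)
  qed
  have R'_left: "(R' * M) $$ (i,p) = M $$ (i,p) - M $$ (j,p)" "(R' * M) $$ (j,p) = M $$ (j,p)"
    if "M \<in> carrier_mat n n" "p < n" for M p
  proof -
    have "(R' * M) $$ (j,p) = (\<Sum>k<n. if k = j then M $$ (j,p) else 0)"
      by (rule trans[OF mult_entry[of _ n] sum.cong[OF refl]]) (use that j neq Rc in \<open>auto simp: R'_def\<close>)
    then show "(R' * M) $$ (j,p) = M $$ (j,p)" using j by simp
    have "(R' * M) $$ (i,p) = (\<Sum>k<n. (if k = i then M $$ (i,p) else 0) - (if k = j then M $$ (j,p) else 0))"
      by (rule trans[OF mult_entry[of _ n] sum.cong[OF refl]]) (use that i neq Rc in \<open>auto simp: R'_def\<close>)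
    then show "(R' * M) $$ (i,p) = M $$ (i,p) - M $$ (j,p)" using i j by (simp add: sum_subtractf)
  qed
  have "R' * R = 1\<^sub>m n"
  proof (rule eq_matI)
    fix p q assume "p < dim_row (1\<^sub>m n)" "q < dim_col (1\<^sub>m n)"
    then have pq: "p < n" "q < n" by auto
    have "(R' * R) $$ (p,q) = (\<Sum>k<n. (if k = p then R $$ (p,q) else 0)
        - (if k = j then (if p = i then R $$ (j,q) else 0) else 0))"
      by (rule trans[OF mult_entry[of _ n] sum.cong[OF refl]]) (use pq neq Rc in \<open>auto simp: R'_def\<close>)
    then show "(R' * R) $$ (p,q) = 1\<^sub>m n $$ (p,q)"
      using pq i j neq by (simp add: sum_subtractf) (auto simp: R_def)
  qed (use Rc in auto)
  moreover from this have "R * R' = 1\<^sub>m n" using mat_mult_left_right_inverse[of R' n R] Rc by simp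
  ultimately obtain w where w: "unitary_n n w" and wR: "w * R \<in> B" and R'w: "R' * adj w \<in> B"
    using fact Rc unfolding unitary_factorization_def by blast
  have wc: "w \<in> carrier_mat n n" using w by (rule unitary_carrier)
  have "cnj (w $$ (p,i)) * (w $$ (p,i) + w $$ (p,j)) = 0" if p: "p < n" for p
  proof (rule ccontr)
    assume nz: "cnj (w $$ (p,i)) * (w $$ (p,i) + w $$ (p,j)) \<noteq> 0"
    have pi: "mat_unit n p i \<in> B"
      using mat_unit_mem[OF wR p i] R_right[OF wc p] nz by auto
    have pj: "mat_unit n p j \<in> B"
      using mat_unit_mem[OF wR p j] R_right[OF wc p] nz by auto
    \<comment> \<open>Composed with E(p,i), such a unit would yield E(j,i). So row j of
      \<open>R' * adj w\<close> vanishes at p, giving w(p,j) = 0; the same argument in row i then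
      gives w(p,i) = w(p,j), and both are zero.\<close>
    have "mat_unit n j p \<notin> B" using unit_trans[OF p _ pi] nji by blast
    then have "w $$ (p,j) = 0"
      using mat_unit_mem[OF R'w j p] R'_left[of "adj w" p] wc p j by (auto simp: adj_entry[of w n])
    moreover have "mat_unit n i p \<notin> B" using unit_trans[OF p _ pj] nij by blast
    then have "cnj (w $$ (p,i)) - cnj (w $$ (p,j)) = 0"
      using mat_unit_mem[OF R'w i p] R'_left[of "adj w" p] wc p i j by (auto simp: adj_entry[of w n])
    ultimately show False using nz by simp
  qed
  then have "(\<Sum>p<n. cnj (w $$ (p,i)) * (w $$ (p,i) + w $$ (p,j))) = 0"
    by (intro sum.neutral) blast
  \<comment> \<open>Orthonormality of the columns of w evaluates the vanishing sum as 1 (from q = i)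
    plus 0 (from q = j), a contradiction.\<close>
  moreover have "(\<Sum>p<n. cnj (w $$ (p,i)) * w $$ (p,q)) = (if i = q then 1 else 0)" if "q < n" for q
  proof -
    have "(\<Sum>p<n. cnj (w $$ (p,i)) * w $$ (p,q)) = (adj w * w) $$ (i,q)"
      using wc i that by (simp add: mult_entry[of _ n] adj_entry[of w n] del: index_mult_mat(1))
    then show ?thesis using w i that by (simp add: unitary_n_def)
  qed
  ultimately show False using i j neq by (simp add: distrib_left sum.distrib)
qed

end

section \<open>Block sizes for a monotone labelling\<close>

text \<open>The end of the last block lies beyond i, so that block is never counted as complete.
  Hence its size does not affect the index, and it can be lengthened freely.\<close>

lemma blk_snoc:
  assumes "i < sum_list ms + m"
  shows "blk (ms @ [m]) i = blk ms i"
proof -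
  have "{k. k < length (ms @ [m]) \<and> sum_list (take (Suc k) (ms @ [m])) \<le> i}
      = {k. k < length ms \<and> sum_list (take (Suc k) ms) \<le> i}"
    using assms by (auto simp: less_Suc_eq)
  then show ?thesis by (simp add: blk_def)
qed

lemma sum_list_take_le: "sum_list (take k ms) \<le> sum_list (ms :: nat list)"
  by (metis append_take_drop_id le_add1 sum_list_append)

lemma blk_ge:
  assumes "sum_list ms \<le> i"
  shows "blk ms i = length ms"
proof -
  have "{k. k < length ms \<and> sum_list (take (Suc k) ms) \<le> i} = {..<length ms}"
    using assms sum_list_take_le[of _ ms] by (auto intro: order_trans)
  then show ?thesis by (simp add: blk_def)
qed

lemma blk_less:
  assumes "i < sum_list ms"
  shows "blk ms i < length ms"
proof (cases ms rule: rev_cases)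
  case (snoc ks k)
  have "blk ks i \<le> length ks" unfolding blk_def
    by (rule order_trans[OF card_mono[of "{..<length ks}"]]) auto
  then show ?thesis using snoc assms by (simp add: blk_snoc)
qed (use assms in simp)

text \<open>The blocks are the level sets of g, which are intervals by monotonicity. Each new
  coordinate either opens a block of size 1 or lengthens the last block, according to whether g
  increases.\<close>

lemma exists_block_sizes:
  fixes g :: "nat \<Rightarrow> nat"
  assumes "\<And>i j. i \<le> j \<Longrightarrow> j < n \<Longrightarrow> g i \<le> g j"
  shows "\<exists>ns. (\<forall>k\<in>set ns. 0 < k) \<and> sum_list ns = n \<and>
    (\<forall>i<n. \<forall>j<n. blk ns i < blk ns j \<longleftrightarrow> g i < g j)"
  using assms
proof (induction n)
  case 0
  show ?case by (rule exI[of _ "[]"]) auto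
next
  case (Suc n)
  then obtain ns where pos: "\<forall>k\<in>set ns. 0 < k" and sum: "sum_list ns = n"
    and ord: "\<And>i j. i < n \<Longrightarrow> j < n \<Longrightarrow> blk ns i < blk ns j \<longleftrightarrow> g i < g j" by force
  have mono: "g i \<le> g n" if "i < n" for i using Suc.prems[of i n] that by simp
  show ?case
  proof (cases "n > 0 \<and> g (n - 1) = g n")
    case False
    have lt: "g i < g n" if "i < n" for i
      using False mono[of "n - 1"] Suc.prems[of i "n - 1"] that by fastforce
    have bn: "blk (ns @ [1]) n = length ns" using sum by (simp add: blk_snoc blk_ge)
    have bi: "blk (ns @ [1]) i = blk ns i" if "i < n" for i using sum that by (simp add: blk_snoc)
    have "blk (ns @ [1]) i < blk (ns @ [1]) j \<longleftrightarrow> g i < g j" if ij: "i < Suc n" "j < Suc n" for i j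
    proof -
      consider "i < n" "j < n" | "i < n" "j = n" | "i = n" "j < n" | "i = n" "j = n"
        using ij by linarith
      then show ?thesis
        by cases (use bi bn ord lt blk_less[of _ ns] sum in \<open>auto dest: less_imp_not_less\<close>)
    qed
    then show ?thesis using pos sum by (intro exI[of _ "ns @ [1]"]) auto
  next
    case True
    then obtain ms m where ns: "ns = ms @ [m]" using sum by (cases ns rule: rev_cases) auto
    have m: "m > 0" using pos ns by simp
    have n: "n = sum_list ms + m" using sum ns by simp
    let ?ns = "ms @ [Suc m]"
    have bi: "blk ?ns i = blk ns i" if "i < n" for i
      using that n unfolding ns by (simp add: blk_snoc)
    have bn: "blk ?ns n = blk ns (n - 1)"
      using m n unfolding ns by (simp add: blk_snoc blk_ge)
    \<comment> \<open>In this case coordinate n shares both its block and its g-value with n - 1, so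
      every comparison reduces to coordinates below n.\<close>
    define \<phi> where "\<phi> i = (if i = n then n - 1 else i)" for i
    have \<phi>: "blk ?ns i = blk ns (\<phi> i)" "g i = g (\<phi> i)" "\<phi> i < n" if "i < Suc n" for i
      using that True bi[of i] bn by (auto simp: \<phi>_def)
    have "blk ?ns i < blk ?ns j \<longleftrightarrow> g i < g j" if ij: "i < Suc n" "j < Suc n" for i j
      using \<phi>[OF ij(1)] \<phi>[OF ij(2)] ord by metis
    then show ?thesis using pos sum ns by (intro exI[of _ ?ns]) auto
  qed
qed

section \<open>Sorting the coordinates and concluding\<close>

text \<open>U is \<open>adj v\<close> with its rows rearranged by \<sigma>, so conjugating by U
  conjugates by \<open>adj v\<close> and then permutes rows and columns simultaneously.\<close>

lemma conj_row_permuted: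
  assumes v: "v \<in> carrier_mat n n" and a: "a \<in> carrier_mat n n"
    and \<sigma>: "\<And>i. i < n \<Longrightarrow> \<sigma> i < n" and ij: "i < n" "j < n"
  defines "U \<equiv> mat n n (\<lambda>(i,j). adj v $$ (\<sigma> i, j))"
  shows "(U * a * adj U) $$ (i,j) = (adj v * a * v) $$ (\<sigma> i, \<sigma> j)"
proof -
  have Uc: "U \<in> carrier_mat n n" by (simp add: U_def)
  have Ua: "(U * a) $$ (i,l) = (adj v * a) $$ (\<sigma> i, l)" if "l < n" for l
    using that ij \<sigma> v a Uc
    by (simp add: mult_entry[of _ n] del: index_mult_mat(1)) (simp add: U_def)
  have Uj: "adj U $$ (l,j) = v $$ (l, \<sigma> j)" if "l < n" for l
    using that ij \<sigma> v Uc by (simp add: adj_entry[of _ n]) (simp add: U_def adj_entry[of _ n])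
  have "(U * a * adj U) $$ (i,j) = (\<Sum>l<n. (U * a) $$ (i,l) * adj U $$ (l,j))"
    using Uc a ij by (intro mult_entry) auto
  also have "\<dots> = (\<Sum>l<n. (adj v * a) $$ (\<sigma> i, l) * v $$ (l, \<sigma> j))"
    by (intro sum.cong refl) (simp add: Ua Uj del: index_mult_mat(1))
  also have "\<dots> = (adj v * a * v) $$ (\<sigma> i, \<sigma> j)"
    using v a \<sigma> ij by (intro mult_entry[symmetric]) auto
  finally show ?thesis .
qed

text \<open>The matrix in the middle is the rank one projection onto column k of v, that is
  \<open>v * mat_unit n k k * adj v\<close>.\<close>

lemma unitary_conj_projection:
  assumes v: "unitary_n n v" and k: "k < n"
  shows "adj v * mat n n (\<lambda>(i,j). v $$ (i,k) * cnj (v $$ (j,k))) * v = mat_unit n k k"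
proof -
  have vc: "v \<in> carrier_mat n n" and vv: "adj v * v = 1\<^sub>m n" using v by (auto simp: unitary_n_def)
  have "mat n n (\<lambda>(i,j). v $$ (i,k) * cnj (v $$ (j,k))) = v * mat_unit n k k * adj v"
  proof (rule eq_matI)
    fix i j assume "i < dim_row (v * mat_unit n k k * adj v)" "j < dim_col (v * mat_unit n k k * adj v)"
    then have ij: "i < n" "j < n" using vc by (auto simp: adj_def)
    have l: "(v * mat_unit n k k) $$ (i,l) = (if l = k then v $$ (i,k) else 0)" if "l < n" for l
    proof -
      have "(v * mat_unit n k k) $$ (i,l) = (\<Sum>p<n. if p = k then (if l = k then v $$ (i,k) else 0) else 0)"
        by (rule trans[OF mult_entry[of _ n] sum.cong[OF refl]])
          (use vc ij that in \<open>auto simp: mat_unit_def\<close>)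
      then show ?thesis using k by simp
    qed
    have "(v * mat_unit n k k * adj v) $$ (i,j) = (\<Sum>l<n. if l = k then v $$ (i,k) * cnj (v $$ (j,k)) else 0)"
      by (rule trans[OF mult_entry[of _ n] sum.cong[OF refl]])
        (use vc ij in \<open>auto simp: l adj_entry[of _ n] simp del: index_mult_mat(1)\<close>)
    then show "mat n n (\<lambda>(i,j). v $$ (i,k) * cnj (v $$ (j,k))) $$ (i,j) = (v * mat_unit n k k * adj v) $$ (i,j)"
      using ij k by simp
  qed (use vc in \<open>auto simp: adj_def\<close>)
  then have "adj v * mat n n (\<lambda>(i,j). v $$ (i,k) * cnj (v $$ (j,k))) * v
      = (adj v * v) * (mat_unit n k k * (adj v * v))"
    using vc by (simp only:) (simp add: assoc_mult_mat[of _ n n _ n _ n])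
  then show ?thesis using vv by simp
qed

theorem mainTheorem7:
  fixes n :: nat and A :: "complex mat set"
  assumes "logmodular n A"
  shows "\<exists>U ns. unitary_n n U \<and> (\<forall>k\<in>set ns. 0 < k) \<and> sum_list ns = n \<and>
           (\<lambda>a. U * a * adj U) ` A = block_upper n ns"
proof -
  have algA: "unital_subalgebra n A" using assms by (simp add: logmodular_def)
  have Ac: "\<And>a. a \<in> A \<Longrightarrow> a \<in> carrier_mat n n" using algA by (auto simp: unital_subalgebra_def)
  have factA: "unitary_factorization n A" using assms by (rule logmodular_unitary_factorization)
  obtain v where v: "unitary_n n v"
    and proj: "\<And>k. k < n \<Longrightarrow> mat n n (\<lambda>(i,j). v $$ (i,k) * cnj (v $$ (j,k))) \<in> A"
    using exists_diagonalizing_unitary[OF algA factA] by blast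
  have vc: "v \<in> carrier_mat n n" using v by (rule unitary_carrier)
  define B where "B = (\<lambda>a. adj v * a * v) ` A"
  interpret diagonal_subalgebra n B
  proof
    show "unital_subalgebra n B" unfolding B_def using algA v by (rule unital_subalgebra_conj)
    show "mat_unit n k k \<in> B" if "k < n" for k
      unfolding B_def using imageI[OF proj[OF that], of "\<lambda>a. adj v * a * v"]
      by (simp only: unitary_conj_projection[OF v that])
  qed
  have factB: "unitary_factorization n B"
    unfolding B_def using factA v by (rule unitary_factorization_conj)
  \<comment> \<open>Counting predecessors turns a total preorder into a numerical label: p lies
    below q exactly when p has at most as many predecessors.\<close>
  define f where "f p = card {q. q < n \<and> mat_unit n q p \<in> B}" for p
  have f_iff: "mat_unit n p q \<in> B \<longleftrightarrow> f p \<le> f q" if pq: "p < n" "q < n" for p q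
  proof
    assume "mat_unit n p q \<in> B"
    then have "{r. r < n \<and> mat_unit n r p \<in> B} \<subseteq> {r. r < n \<and> mat_unit n r q \<in> B}"
      using unit_trans[OF pq(1)] by blast
    then show "f p \<le> f q" unfolding f_def by (intro card_mono) auto
  next
    assume le: "f p \<le> f q"
    show "mat_unit n p q \<in> B"
    proof (rule ccontr)
      assume n: "mat_unit n p q \<notin> B"
      then have "mat_unit n q p \<in> B" using unit_total[OF factB] pq by blast
      \<comment> \<open>The inclusion is strict because p precedes itself but does not precede
        q.\<close>
      then have "{r. r < n \<and> mat_unit n r q \<in> B} \<subset> {r. r < n \<and> mat_unit n r p \<in> B}"
        using n diag[OF pq(1)] pq(1) unit_trans[OF pq(2)] by blast
      then have "f q < f p" unfolding f_def by (intro psubset_card_mono) auto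
      then show False using le by simp
    qed
  qed
  define xs where "xs = sort_key f [0..<n]"
  have xs: "length xs = n" "distinct xs" "set xs = {..<n}" "sorted (map f xs)"
    by (auto simp: xs_def)
  define \<sigma> where "\<sigma> i = xs ! i" for i
  have \<sigma>: "\<sigma> i < n" if "i < n" for i using xs that nth_mem[of i xs] by (auto simp: \<sigma>_def)
  have bij: "bij_betw \<sigma> {..<n} {..<n}"
  proof -
    have "\<sigma> = (!) xs" by (rule ext) (simp add: \<sigma>_def)
    then show ?thesis using bij_betw_nth[OF xs(2) refl refl] xs(1,3) by simp
  qed
  have mono: "f (\<sigma> i) \<le> f (\<sigma> j)" if "i \<le> j" "j < n" for i j
    using sorted_nth_mono[OF xs(4) that(1)] that xs(1) by (simp add: \<sigma>_def)
  have "\<exists>ns. (\<forall>k\<in>set ns. 0 < k) \<and> sum_list ns = n \<and>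
      (\<forall>i<n. \<forall>j<n. blk ns i < blk ns j \<longleftrightarrow> f (\<sigma> i) < f (\<sigma> j))"
    by (rule exists_block_sizes) (rule mono)
  then obtain ns where ns: "\<forall>k\<in>set ns. 0 < k" "sum_list ns = n"
    and blk: "\<And>i j. i < n \<Longrightarrow> j < n \<Longrightarrow> blk ns i < blk ns j \<longleftrightarrow> f (\<sigma> i) < f (\<sigma> j)"
    by auto
  define U where "U = mat n n (\<lambda>(i,j). adj v $$ (\<sigma> i, j))"
  have Uc: "U \<in> carrier_mat n n" by (simp add: U_def)
  have U_entry: "(U * a * adj U) $$ (i,j) = (adj v * a * v) $$ (\<sigma> i, \<sigma> j)"
    if "a \<in> carrier_mat n n" "i < n" "j < n" for a i j
    unfolding U_def using vc that \<sigma> by (intro conj_row_permuted) auto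
  have "U * adj U = 1\<^sub>m n"
  proof (rule eq_matI)
    fix i j assume "i < dim_row (1\<^sub>m n)" "j < dim_col (1\<^sub>m n)"
    then have ij: "i < n" "j < n" by auto
    \<comment> \<open>This is the entry formula for the conjugate of the identity matrix.\<close>
    have "(U * adj U) $$ (i,j) = (adj v * v) $$ (\<sigma> i, \<sigma> j)"
      using U_entry[OF one_carrier_mat ij] Uc vc by simp
    also have "\<dots> = (if \<sigma> i = \<sigma> j then 1 else 0)" using v \<sigma> ij by (simp add: unitary_n_def)
    also have "\<dots> = 1\<^sub>m n $$ (i,j)"
      using ij bij_betw_imp_inj_on[OF bij] by (auto dest: inj_onD)
    finally show "(U * adj U) $$ (i,j) = 1\<^sub>m n $$ (i,j)" .
  qed (use Uc in \<open>auto simp: adj_def\<close>)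
  then have U: "unitary_n n U"
    using unitary_adj[OF unitary_nI[of "adj U" n]] Uc by simp
  have "(\<lambda>a. U * a * adj U) ` A = block_upper n ns"
  proof (intro equalityI subsetI)
    fix M assume "M \<in> (\<lambda>a. U * a * adj U) ` A"
    then obtain a where a: "a \<in> A" "M = U * a * adj U" by blast
    have "M $$ (i,j) = 0" if ij: "i < n" "j < n" "blk ns j < blk ns i" for i j
    proof -
      have "mat_unit n (\<sigma> i) (\<sigma> j) \<notin> B" using f_iff blk ij \<sigma> by simp
      then have "(adj v * a * v) $$ (\<sigma> i, \<sigma> j) = 0"
        using mat_unit_mem[of "adj v * a * v"] a(1) \<sigma> ij unfolding B_def by blast
      then show ?thesis using U_entry[of a i j] Ac a ij by simp
    qed
    then show "M \<in> block_upper n ns" using a Ac Uc by (auto simp: block_upper_def)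
  next
    fix M assume M: "M \<in> block_upper n ns"
    then have Mc: "M \<in> carrier_mat n n" by (simp add: block_upper_def)
    define \<tau> where "\<tau> = inv_into {..<n} \<sigma>"
    have \<tau>: "\<tau> p < n" "\<sigma> (\<tau> p) = p" if "p < n" for p
    proof -
      have "p \<in> \<sigma> ` {..<n}" using bij that by (simp add: bij_betw_def)
      then show "\<tau> p < n" "\<sigma> (\<tau> p) = p"
        unfolding \<tau>_def using inv_into_into[of p \<sigma> "{..<n}"] f_inv_into_f[of p \<sigma> "{..<n}"] by auto
    qed
    have \<tau>\<sigma>: "\<tau> (\<sigma> i) = i" if "i < n" for i
      unfolding \<tau>_def using bij that by (simp add: bij_betw_def)
    \<comment> \<open>Undoing the permutation: N has to be the conjugate by \<open>adj v\<close> of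
      the element of A that is sought, and its support decides that it lies in B.\<close>
    define N where "N = mat n n (\<lambda>(p,q). M $$ (\<tau> p, \<tau> q))"
    have "mat_unit n p q \<in> B" if pq: "p < n" "q < n" and "N $$ (p,q) \<noteq> 0" for p q
    proof -
      have "\<not> blk ns (\<tau> q) < blk ns (\<tau> p)" using that M \<tau> by (auto simp: N_def block_upper_def)
      then show ?thesis using f_iff[OF pq] blk[of "\<tau> q" "\<tau> p"] \<tau> pq by simp
    qed
    then have "N \<in> B" using mem_iff[of N] by (simp add: N_def)
    then obtain a where a: "a \<in> A" "N = adj v * a * v" unfolding B_def by blast
    have "U * a * adj U = M"
    proof (rule eq_matI)
      fix i j assume "i < dim_row M" "j < dim_col M"
      then have ij: "i < n" "j < n" using Mc by auto
      have "(U * a * adj U) $$ (i,j) = N $$ (\<sigma> i, \<sigma> j)" using U_entry[of a i j] Ac a ij by simp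
      then show "(U * a * adj U) $$ (i,j) = M $$ (i,j)" using ij \<sigma> \<tau>\<sigma> by (simp add: N_def)
    qed (use Uc Mc in \<open>auto simp: adj_def\<close>)
    then show "M \<in> (\<lambda>a. U * a * adj U) ` A" using a by blast
  qed
  then show ?thesis using U ns by blast
qed

end
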